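(* Let $m\ge2$ and let $f_c(x)=x^m+c$. If $p$ is a prime not dividing $m$ but dividing $n$, where $n>3$, then $Y_1(n)$ has bad reduction modulo $p$.
   Context: Let $f_c(x)=x^m+c$, and let $f_c^n$ be the $n$-th iterate in $x$. Put $\Psi_n(x,c)=f_c^n(x)-x$ and $\Phi_n(x,c)=\prod_{d\mid n}\Psi_d(x,c)^{\mu(n/d)}\in\mathbb{Z}[x,c]$ (the $n$-th dynatomic polynomial). $Y_1(n)$ is the closed subscheme of $\mathbb{A}^2_{\mathbb{Z}}$ defined by $\Phi_n(x,c)=0$. It has good reduction modulo $p$ if its fiber $Y_1(n)_{\mathbb{F}_p}$ is smooth over $\mathbb{F}_p$, and bad reduction modulo $p$ otherwise. *)

theory Defs
  imports
    "HOL-Computational_Algebra.Computational_Algebra"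
    "HOL-Algebra.Ideal"
    "HOL-Decision_Procs.Algebra_Aux"
begin

text \<open>
  Elements of \<open>\<int>[x,c]\<close> are represented as \<open>int poly poly\<close>: the outer variable is \<open>x\<close>, and the
  coefficients lie in \<open>\<int>[c]\<close>.
\<close>

definition var_x :: "int poly poly" where
  "var_x = [:0, 1:]"

definition var_c :: "int poly poly" where
  "var_c = [:[:0, 1:]:]"

definition deriv_x :: "int poly poly \<Rightarrow> int poly poly" where
  "deriv_x F = pderiv F"

definition deriv_c :: "int poly poly \<Rightarrow> int poly poly" where
  "deriv_c F = map_poly pderiv F"

definition moebius_mu :: "nat \<Rightarrow> int" where
  "moebius_mu k = (if squarefree k then (- 1) ^ card (prime_factors k) else 0)"

definition unicritical :: "nat \<Rightarrow> int poly poly" where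
  "unicritical m = var_x ^ m + var_c"

definition unicritical_iter :: "nat \<Rightarrow> nat \<Rightarrow> int poly poly" where
  "unicritical_iter m n = ((\<lambda>g. pcompose (unicritical m) g) ^^ n) var_x"

definition Psi :: "nat \<Rightarrow> nat \<Rightarrow> int poly poly" where
  "Psi m n = unicritical_iter m n - var_x"

text \<open>
  The exponents in the product may be negative, so the product is formed in the fraction field.
  For \<open>m \<ge> 2\<close> and \<open>n \<ge> 1\<close> it is a classical fact that it lies in \<open>\<int>[x,c]\<close>; the \<open>THE\<close> picks
  that (unique, since \<open>to_fract\<close> is injective) polynomial.
\<close>

definition dynatomic :: "nat \<Rightarrow> nat \<Rightarrow> int poly poly" where
  "dynatomic m n =
     (THE F. to_fract F = (\<Prod>d | d dvd n. to_fract (Psi m d) powi moebius_mu (n div d)))"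

text \<open>
  Let \<open>Y\<close> be the closed subscheme \<open>F = 0\<close> of the affine plane over \<open>\<int>\<close>. Its fibre over \<open>p\<close> is
  \<open>Spec (\<int>[x,c] / (p, F))\<close>, whose points are the prime ideals of \<open>\<int>[x,c]\<close> containing \<open>p\<close> and \<open>F\<close>.
\<close>

definition fibre_points :: "int poly poly \<Rightarrow> nat \<Rightarrow> int poly poly set set" where
  "fibre_points F p =
     {P. primeideal P (cring_class_ops :: int poly poly ring) \<and> of_nat p \<in> P \<and> F \<in> P}"

text \<open>
  Smoothness over \<open>\<bbbF>\<^sub>p\<close> of the fibre, a closed subscheme of the affine plane over \<open>\<bbbF>\<^sub>p\<close> cut out by
  one equation: at every point \<open>P\<close> the Jacobian matrix \<open>(\<partial>F/\<partial>x, \<partial>F/\<partial>c)\<close>, with entries in the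
  residue field \<open>Frac (\<int>[x,c] / P)\<close>, has rank equal to the codimension of the fibre in the plane.
  An element of \<open>\<int>[x,c]\<close> is zero in that residue field iff it lies in \<open>P\<close>. The codimension is 1
  unless \<open>F\<close> vanishes modulo \<open>p\<close>, in which case the fibre is the whole plane and is smooth.
\<close>

definition smooth_fibre :: "int poly poly \<Rightarrow> nat \<Rightarrow> bool" where
  "smooth_fibre F p \<longleftrightarrow>
     of_nat p dvd F \<or> (\<forall>P \<in> fibre_points F p. deriv_x F \<notin> P \<or> deriv_c F \<notin> P)"

definition Y1_good_reduction :: "nat \<Rightarrow> nat \<Rightarrow> nat \<Rightarrow> bool" where
  "Y1_good_reduction m n p \<longleftrightarrow> smooth_fibre (dynatomic m n) p"

abbreviation Y1_bad_reduction :: "nat \<Rightarrow> nat \<Rightarrow> nat \<Rightarrow> bool" where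
  "Y1_bad_reduction m n p \<equiv> \<not> Y1_good_reduction m n p"

end

(*
  Let n = p^e r with p not dividing r, and q = n / p. On the curve c = x - x^m of fixed points the
  multiplier is m x^(m-1); pick a point over a prime above p where it has exact order r. Near this
  point Phi_n is a unit times U = Psi_n / Psi_q. Since f^q is x + h with h = Psi_q and h, h' vanish
  at the point, expanding the p-fold iterate of x + h shows that, modulo the prime,
    U = p = 0  and  dU = (sum_{i<p} i) dh' + (sum_{i<p} i^2) (h''/2) dh.
  Both sums vanish mod p if p > 3. If p = 2 or 3, then n > 3 gives q > 1 and dh = 0, because h is
  the product of Psi_1 and Psi_q / Psi_1, which both vanish at the point. The first sum vanishes for
  p = 3, and for p = 2 the exponent m is odd, so h' + 1 is a constant times a square and dh' = 0.
*)

theory Submission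
  imports Defs
begin

subsection \<open>Divisor sums and products\<close>

text \<open>The order \<open>r\<close> of the multiplier does two jobs. Because \<open>r\<close>
  divides \<open>q\<close>, the derivative h' vanishes at the point. Because the order is no
  smaller, the denominators of Phi_n do not vanish there: they are quotients Psi_(n/D) /
  Psi_(n/(pD)) with D \<noteq> 1 prime to p, and such a quotient can vanish only if \<open>r\<close>
  divides n/D, which forces D to divide p^e. Such a point exists because \<open>p\<close> does not
  divide \<open>r\<close>: X^r - 1 stays separable modulo p, so an irreducible factor of it that
  divides no X^k - 1 with 0 < k < r does the work of a cyclotomic polynomial. A separate obstacle is
  that \<open>dynatomic\<close> is a \<open>THE\<close> over the fraction field: nothing can be said
  about it until the Moebius product is known to be a polynomial. In the factorial ring Z[x,c] this
  is a comparison of multiplicities, which works because every \<open>Psi m d\<close> with d > 0 is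
  squarefree.\<close>

lemma add_mult_mem_shift_closed:
  fixes S :: "nat set"
  assumes "\<And>a b. b \<in> S \<Longrightarrow> a + b \<in> S \<longleftrightarrow> a \<in> S" and "b \<in> S"
  shows "a + k * b \<in> S \<longleftrightarrow> a \<in> S"
proof (induction k)
  case (Suc k)
  have "a + Suc k * b = (a + k * b) + b" by simp
  then show ?case using assms Suc by metis
qed simp

text \<open>Euclid's algorithm never leaves \<open>S\<close>. Applied to the indices
  \<open>d\<close> for which a prime divides \<open>Psi m d\<close>, and to the exponents at which
  the power of the multiplier is 1.\<close>

lemma gcd_mem_shift_closed:
  fixes S :: "nat set"
  assumes shift: "\<And>a b. b \<in> S \<Longrightarrow> a + b \<in> S \<longleftrightarrow> a \<in> S"
    and "a \<in> S" and "b \<in> S"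
  shows "gcd a b \<in> S"
  using assms(2,3)
proof (induction a b rule: gcd_nat_induct)
  case (step a b)
  have "a mod b + (a div b) * b = a" by simp
  then have "a mod b \<in> S"
    using step.prems add_mult_mem_shift_closed[OF shift] by metis
  then show ?case
    using step by (metis gcd_red_nat)
qed simp

lemma moebius_mu_1 [simp]: "moebius_mu (Suc 0) = 1"
  by (simp add: moebius_mu_def)

lemma moebius_mu_prime_mult:
  assumes l: "prime l" and D: "\<not> l dvd D"
  shows "moebius_mu (l * D) = - moebius_mu D"
proof -
  have cop: "coprime l D" using assms by (simp add: prime_imp_coprime)
  have D0: "D \<noteq> 0" using D by (metis dvd_0_right)
  have sq: "squarefree (l * D) \<longleftrightarrow> squarefree D"
    using cop l squarefree_mult_coprime squarefree_multD(2) squarefree_prime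
    by blast
  have pf: "prime_factors (l * D) = insert l (prime_factors D)"
    using l D0 by (subst prime_factors_product) (auto simp: prime_prime_factors)
  have "l \<notin> prime_factors D" using D by auto
  then show ?thesis
    by (simp add: moebius_mu_def sq pf)
qed

text \<open>Pairing \<open>D\<close> with \<open>l * D\<close>, where the Moebius function changes
  sign, cancels sums over divisors and turns products over divisors into products of
  quotients.\<close>

lemma squarefree_divisors_split:
  fixes l n :: nat
  assumes l: "prime l" and ln: "l dvd n"
  defines "S \<equiv> {D. D dvd n \<and> squarefree D \<and> \<not> l dvd D}"
  shows "{D. D dvd n \<and> squarefree D} = S \<union> (\<lambda>D. l * D) ` S"
    and "S \<inter> (\<lambda>D. l * D) ` S = {}"
    and "inj_on (\<lambda>D. l * D) S"
proof -
  show "S \<inter> (\<lambda>D. l * D) ` S = {}" by (auto simp: S_def)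
  show "inj_on (\<lambda>D. l * D) S" using l by (auto simp: inj_on_def)
  show "{D. D dvd n \<and> squarefree D} = S \<union> (\<lambda>D. l * D) ` S" (is "?L = ?R")
  proof (intro equalityI subsetI)
    fix D assume D: "D \<in> ?L"
    show "D \<in> ?R"
    proof (cases "l dvd D")
      case True
      then obtain E where E: "D = l * E" by blast
      have "\<not> l dvd E"
      proof
        assume "l dvd E"
        then have "l ^ 2 dvd D" by (simp add: E power2_eq_square)
        then have "is_unit l" using D by (auto simp: squarefree_def)
        then show False using l by auto
      qed
      moreover have "squarefree E" using D E squarefree_multD(2) by auto
      moreover have "E dvd n" using D E by (auto dest: dvd_mult_right)
      ultimately show ?thesis by (auto simp: S_def E)
    qed (use D in \<open>auto simp: S_def\<close>)
  next
    fix D assume "D \<in> ?R"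
    then show "D \<in> ?L"
    proof
      assume "D \<in> (\<lambda>D. l * D) ` S"
      then obtain E where E: "E \<in> S" "D = l * E" by blast
      have "coprime l E" using l E by (simp add: prime_imp_coprime S_def)
      then have "l * E dvd n" "squarefree (l * E)"
        using E ln l by (auto simp: S_def divides_mult squarefree_mult_coprime squarefree_prime)
      then show ?thesis by (simp add: E)
    qed (auto simp: S_def)
  qed
qed

lemma sum_moebius_mu_eq_0:
  assumes "n > 1"
  shows "(\<Sum>D | D dvd n. moebius_mu D) = 0"
proof -
  obtain l where l: "prime l" "l dvd n" using assms prime_factor_nat[of n] by auto
  define S where "S = {D. D dvd n \<and> squarefree D \<and> \<not> l dvd D}"
  note split = squarefree_divisors_split[OF l, folded S_def]
  have fin: "finite {D. D dvd n}" using assms by simp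
  then have finS: "finite S" by (rule rev_finite_subset) (auto simp: S_def)
  have "(\<Sum>D | D dvd n. moebius_mu D) = (\<Sum>D | D dvd n \<and> squarefree D. moebius_mu D)"
    using fin by (intro sum.mono_neutral_right) (auto simp: moebius_mu_def)
  also have "\<dots> = (\<Sum>D\<in>S. moebius_mu D) + (\<Sum>D\<in>S. moebius_mu (l * D))"
    unfolding split(1) using split(2,3) finS
    by (simp add: sum.union_disjoint sum.reindex)
  also have "(\<Sum>D\<in>S. moebius_mu (l * D)) = (\<Sum>D\<in>S. - moebius_mu D)"
    by (intro sum.cong) (auto simp: S_def moebius_mu_prime_mult l)
  finally show ?thesis by (simp add: sum_negf)
qed

text \<open>With \<open>l = p\<close> and \<open>F\<close> given by \<open>Psi m\<close>, the
  quotients on the right are polynomials, and the one for \<open>D = 1\<close> is the U of the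
  overview.\<close>

lemma prod_powi_moebius_mu:
  fixes F :: "nat \<Rightarrow> 'a :: field"
  assumes l: "prime l" "l dvd n" and n: "n > 0"
  shows "(\<Prod>d | d dvd n. F d powi moebius_mu (n div d)) =
    (\<Prod>D | D dvd n \<and> squarefree D \<and> \<not> l dvd D. (F (n div D) / F (n div (l * D))) powi moebius_mu D)"
proof -
  define S where "S = {D. D dvd n \<and> squarefree D \<and> \<not> l dvd D}"
  note split = squarefree_divisors_split[OF l, folded S_def]
  have fin: "finite {D. D dvd n}" using n by simp
  then have finS: "finite S" by (rule rev_finite_subset) (auto simp: S_def)
  have "(\<Prod>d | d dvd n. F d powi moebius_mu (n div d)) =
      (\<Prod>D | D dvd n. F (n div D) powi moebius_mu D)"
    by (rule prod.reindex_bij_witness[of _ "\<lambda>d. n div d" "\<lambda>d. n div d"]) (use n in auto)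
  also have "\<dots> = (\<Prod>D | D dvd n \<and> squarefree D. F (n div D) powi moebius_mu D)"
    using fin by (intro prod.mono_neutral_right) (auto simp: moebius_mu_def)
  also have "\<dots> = (\<Prod>D\<in>S. F (n div D) powi moebius_mu D) *
      (\<Prod>D\<in>S. F (n div (l * D)) powi moebius_mu (l * D))"
    unfolding split(1) using split(2,3) finS
    by (simp add: prod.union_disjoint prod.reindex)
  also have "\<dots> = (\<Prod>D\<in>S. F (n div D) powi moebius_mu D * F (n div (l * D)) powi moebius_mu (l * D))"
    by (simp add: prod.distrib)
  also have "\<dots> = (\<Prod>D\<in>S. (F (n div D) / F (n div (l * D))) powi moebius_mu D)"
    by (intro prod.cong)
      (auto simp: S_def moebius_mu_prime_mult l power_int_minus power_int_divide_distrib
        divide_inverse power_int_mult_distrib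
        simp flip: power_int_inverse)
  finally show ?thesis by (simp add: S_def)
qed

subsection \<open>Prime ideals of commutative rings\<close>

text \<open>Prime ideals in terms of the type class operations, which keeps ring records out of the
  calculations; \<open>primeideal_cring_class_ops\<close> leads back to the notion in
  \<open>fibre_points\<close>.\<close>

locale class_prime_ideal =
  fixes P :: "'a::comm_ring_1 set"
  assumes zero_mem [simp]: "0 \<in> P"
    and add_mem: "x \<in> P \<Longrightarrow> y \<in> P \<Longrightarrow> x + y \<in> P"
    and mult_mem: "y \<in> P \<Longrightarrow> x * y \<in> P"
    and one_notin: "1 \<notin> P"
    and prime_mem: "x * y \<in> P \<Longrightarrow> x \<in> P \<or> y \<in> P"
begin

lemma mult_mem': "x \<in> P \<Longrightarrow> x * y \<in> P"
  using mult_mem[of x y] by (simp add: mult.commute)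

lemma uminus_mem: "x \<in> P \<Longrightarrow> - x \<in> P"
  using mult_mem[of x "-1"] by simp

lemma diff_mem: "x \<in> P \<Longrightarrow> y \<in> P \<Longrightarrow> x - y \<in> P"
  using add_mem[of x "- y"] uminus_mem by simp

lemmas mems = add_mem mult_mem mult_mem' uminus_mem diff_mem

lemma mem_cong: "x - y \<in> P \<Longrightarrow> x \<in> P \<longleftrightarrow> y \<in> P"
  by (metis add_mem diff_add_cancel diff_diff_eq2 diff_mem add_diff_cancel_left')

lemma dvd_mem: "x dvd y \<Longrightarrow> x \<in> P \<Longrightarrow> y \<in> P"
  by (auto intro: mult_mem')

lemma prod_mem: "finite A \<Longrightarrow> prod f A \<in> P \<Longrightarrow> \<exists>a\<in>A. f a \<in> P"
  by (induction A rule: finite_induct) (auto simp: one_notin dest: prime_mem)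

lemma primeideal_cring_class_ops: "primeideal P cring_class_ops"
proof (rule primeidealI)
  show "ideal P cring_class_ops"
  proof (rule idealI)
    show ring: "ring (cring_class_ops :: 'a ring)"
      using cring_class by (rule cring.axioms)
    show "subgroup P (add_monoid cring_class_ops)"
    proof (rule group.subgroupI[OF abelian_group.a_group[OF ring.axioms(1)[OF ring]]])
      fix a assume "a \<in> P"
      then show "inv\<^bsub>add_monoid cring_class_ops\<^esub> a \<in> P"
        by (metis a_inv_def uminus_class uminus_mem)
    next
      show "P \<noteq> {}" using zero_mem by blast
    qed (auto simp: class_simps carrier_class add_mem)
  qed (auto simp: class_simps mult_mem mult_mem')
qed (use cring_class one_notin prime_mem in \<open>auto simp: class_simps\<close>)

end

lemma exists_prime_ideal:
  fixes a b :: "'a :: comm_ring_1"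
  assumes proper: "\<And>u v. u * a + v * b \<noteq> 1"
  obtains J where "class_prime_ideal J" "a \<in> J" "b \<in> J"
proof -
  define \<A> :: "'a set set" where "\<A> = {I. 0 \<in> I \<and> (\<forall>x\<in>I. \<forall>y\<in>I. x + y \<in> I) \<and> (\<forall>x. \<forall>y\<in>I. x * y \<in> I)
    \<and> 1 \<notin> I \<and> a \<in> I \<and> b \<in> I}"
  have "range (\<lambda>(u, v). u * a + v * b) \<in> \<A>"
  proof -
    have "\<exists>u' v'. u * a + v * b + (w * a + z * b) = u' * a + v' * b" for u v w z
      by (rule exI[of _ "u + w"], rule exI[of _ "v + z"]) (simp add: algebra_simps)
    moreover have "\<exists>u' v'. x * (u * a + v * b) = u' * a + v' * b" for u v x
      by (rule exI[of _ "x * u"], rule exI[of _ "x * v"]) (simp add: algebra_simps)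
    moreover have "\<exists>u v. c = u * a + v * b" if "c \<in> {0, a, b}" for c
    proof -
      have "0 = 0 * a + 0 * b" "a = 1 * a + 0 * b" "b = 0 * a + 1 * b" by simp_all
      then show ?thesis using that by blast
    qed
    ultimately show ?thesis
      using proper unfolding \<A>_def by (auto simp: image_iff) metis+
  qed
  then have ne: "\<A> \<noteq> {}" by blast
  have "\<Union>\<C> \<in> \<A>" if \<C>: "\<C> \<noteq> {}" "subset.chain \<A> \<C>" for \<C>
  proof -
    have sub: "I \<in> \<A>" if "I \<in> \<C>" for I
      using \<C>(2) that by (auto simp: subset.chain_def)
    have tot: "I \<subseteq> I' \<or> I' \<subseteq> I" if "I \<in> \<C>" "I' \<in> \<C>" for I I'
      using \<C>(2) that by (auto simp: subset.chain_def)
    have "x + y \<in> \<Union>\<C>" if xy: "x \<in> I" "I \<in> \<C>" "y \<in> I'" "I' \<in> \<C>" for x y I I'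
    proof -
      obtain I'' where "I'' \<in> \<C>" "x \<in> I''" "y \<in> I''"
        using tot[OF xy(2,4)] xy by blast
      then show ?thesis using sub[of I''] by (auto simp: \<A>_def)
    qed
    then show ?thesis using sub \<C>(1) unfolding \<A>_def by blast
  qed
  from subset_Zorn_nonempty[OF ne this] obtain M
    where M: "M \<in> \<A>" and max: "\<And>X. X \<in> \<A> \<Longrightarrow> M \<subseteq> X \<Longrightarrow> X = M" by blast
  have M': "0 \<in> M" "\<And>x y. x \<in> M \<Longrightarrow> y \<in> M \<Longrightarrow> x + y \<in> M" "\<And>x y. y \<in> M \<Longrightarrow> x * y \<in> M" "1 \<notin> M"
    "a \<in> M" "b \<in> M"
    using M by (auto simp: \<A>_def)
  \<comment> \<open>By maximality, the ideal generated by \<open>M\<close> and \<open>x\<close>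
    contains 1.\<close>
  have unit: "\<exists>m u. m \<in> M \<and> 1 = m + u * x" if x: "x \<notin> M" for x
  proof (rule ccontr)
    assume no: "\<not> ?thesis"
    define X where "X = {m + u * x | m u. m \<in> M}"
    have sub: "M \<subseteq> X"
    proof
      fix y assume "y \<in> M"
      then have "y + 0 * x \<in> X" unfolding X_def by blast
      then show "y \<in> X" by simp
    qed
    have "0 + 1 * x \<in> X" unfolding X_def using M'(1) by blast
    then have "x \<in> X" by simp
    moreover have "X \<in> \<A>"
    proof -
      have "(m + u * x) + (m' + u' * x) \<in> X" if "m \<in> M" "m' \<in> M" for m m' u u'
      proof -
        have "(m + u * x) + (m' + u' * x) = (m + m') + (u + u') * x" by (simp add: algebra_simps)
        then show ?thesis using M'(2)[OF that] unfolding X_def by blast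
      qed
      moreover have "y * (m + u * x) \<in> X" if "m \<in> M" for y m u
      proof -
        have "y * (m + u * x) = y * m + (y * u) * x" by (simp add: algebra_simps)
        then show ?thesis using M'(3)[OF that, of y] unfolding X_def by blast
      qed
      moreover have "0 \<in> X" "a \<in> X" "b \<in> X" using sub M' by blast+
      moreover have "1 \<notin> X" using no by (auto simp: X_def)
      ultimately show ?thesis
        unfolding \<A>_def by (force simp: X_def)
    qed
    ultimately show False using max[OF _ sub] x by blast
  qed
  have "class_prime_ideal M"
  proof
    fix x y assume xy: "x * y \<in> M"
    show "x \<in> M \<or> y \<in> M"
    proof (rule ccontr)
      assume "\<not> ?thesis"
      then obtain m u m' u' where *: "m \<in> M" "1 = m + u * x" "m' \<in> M" "1 = m' + u' * y"
        using unit by metis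
      have "1 = (m + u * x) * (m' + u' * y)" using *(2,4) by simp
      also have "\<dots> = m' * m + (u' * y) * m + (u * x) * m' + (u * u') * (x * y)"
        by (simp add: algebra_simps)
      also have "\<dots> \<in> M"
        by (intro M'(2)) (auto intro: M'(3) *(1,3) xy)
      finally show False using M'(4) by simp
    qed
  qed (use M' in auto)
  then show ?thesis using that M' by blast
qed

subsection \<open>Polynomials and derivations\<close>

text \<open>Modulo \<open>l\<close> the coefficients form a domain and \<open>C\<close> keeps its
  positive degree, so it is not a unit there. Serves to exclude square factors of
  \<open>Psi m n\<close> and to show that an ideal containing \<open>p\<close> is proper.\<close>

lemma prime_dvd_all_coeffs_of_unit:
  fixes C :: "'a :: idom poly"
  assumes l: "prime_elem l" and lc: "\<not> l dvd lead_coeff C" and deg: "degree C > 0"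
  shows "\<not> [:l:] dvd C * B - 1"
proof
  assume *: "[:l:] dvd C * B - 1"
  have l1: "\<not> l dvd 1" using l by (auto simp: prime_elem_def)
  have "\<exists>i. \<not> l dvd coeff B i"
  proof (rule ccontr)
    assume "\<not> ?thesis"
    then have "[:l:] dvd B" by (simp add: const_poly_dvd_iff)
    then have "[:l:] dvd C * B" by (rule dvd_mult)
    then have "[:l:] dvd 1" using * by (metis dvd_diff_commute diff_add_cancel dvd_add_right_iff)
    then show False using l1 by (auto simp: const_poly_dvd_iff dest: spec[of _ 0])
  qed
  then obtain i0 where i0: "\<not> l dvd coeff B i0" by blast
  have bound: "\<forall>i. \<not> l dvd coeff B i \<longrightarrow> i \<le> degree B"
    using le_degree by force
  \<comment> \<open>The degree of \<open>B\<close> modulo \<open>l\<close>.\<close>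
  define i where "i = (GREATEST i. \<not> l dvd coeff B i)"
  have i: "\<not> l dvd coeff B i"
    unfolding i_def
    by (rule GreatestI_nat[where P = "\<lambda>i. \<not> l dvd coeff B i", OF i0]) (use bound in auto)
  have i': "l dvd coeff B j" if "j > i" for j
    using Greatest_le_nat[of "\<lambda>i. \<not> l dvd coeff B i" j "degree B"] bound that
    unfolding i_def[symmetric] by force
  define N where "N = degree C + i"
  have "coeff (C * B) N = (\<Sum>k\<le>N. coeff C k * coeff B (N - k))"
    by (simp add: coeff_mult)
  also have "\<dots> = lead_coeff C * coeff B i + (\<Sum>k\<in>{..N} - {degree C}. coeff C k * coeff B (N - k))"
    by (subst sum.remove[of _ "degree C"]) (auto simp: N_def)
  finally have eq: "coeff (C * B) N = \<dots>" .
  have "l dvd (\<Sum>k\<in>{..N} - {degree C}. coeff C k * coeff B (N - k))"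
  proof (rule dvd_sum)
    fix k assume k: "k \<in> {..N} - {degree C}"
    show "l dvd coeff C k * coeff B (N - k)"
    proof (cases "k < degree C")
      case True
      then show ?thesis by (intro dvd_mult i') (simp add: N_def)
    next
      case False
      then show ?thesis using k by (simp add: coeff_eq_0)
    qed
  qed
  moreover have "\<not> l dvd lead_coeff C * coeff B i"
    using l lc i by (simp add: prime_elem_dvd_mult_iff)
  ultimately have "\<not> l dvd coeff (C * B) N"
    unfolding eq by (simp add: dvd_add_left_iff)
  moreover have "coeff 1 N = 0" using deg by (simp add: N_def)
  ultimately show False
    using * unfolding const_poly_dvd_iff by (metis coeff_diff diff_zero)
qed

text \<open>\<open>G\<close> takes the place of F''/2, so no division by 2 occurs. Third order
  suffices: for F = h and Y = h W, dividing by h leaves a remainder with the factor h^2, whose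
  derivatives still contain h.\<close>

lemma pcompose_add_X_Taylor:
  fixes F :: "'a :: idom poly"
  obtains G R where "\<And>Y. pcompose F ([:0, 1:] + Y) = F + Y * pderiv F + Y\<^sup>2 * G + Y ^ 3 * R Y"
proof -
  have "\<exists>G R. \<forall>Y. pcompose F ([:0, 1:] + Y) = F + Y * pderiv F + Y\<^sup>2 * G + Y ^ 3 * R Y"
  proof (induction F)
    case (pCons a F)
    then obtain G R where
      IH: "\<And>Y. pcompose F ([:0, 1:] + Y) = F + Y * pderiv F + Y\<^sup>2 * G + Y ^ 3 * R Y" by blast
    define X :: "'a poly" where "X = [:0, 1:]"
    have eq: "pCons a F = [:a:] + X * F" "pderiv (pCons a F) = F + X * pderiv F"
      by (simp_all add: X_def pderiv_pCons)
    have "pcompose (pCons a F) (X + Y) = pCons a F + Y * pderiv (pCons a F) +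
        Y\<^sup>2 * (pderiv F + X * G) + Y ^ 3 * (G + X * R Y + Y * R Y)" for Y
    proof -
      have "pcompose (pCons a F) (X + Y) =
          [:a:] + (X + Y) * (F + Y * pderiv F + Y\<^sup>2 * G + Y ^ 3 * R Y)"
        by (simp only: pcompose_pCons IH[folded X_def])
      then show ?thesis
        unfolding eq(2) unfolding eq(1) by (simp add: power2_eq_square power3_eq_cube algebra_simps)
    qed
    then have "\<forall>Y. pcompose (pCons a F) ([:0, 1:] + Y) = pCons a F + Y * pderiv (pCons a F) +
        Y\<^sup>2 * (pderiv F + X * G) + Y ^ 3 * (G + X * R Y + Y * R Y)"
      by (simp add: X_def)
    then show ?case by (intro exI)
  qed (intro exI[of _ 0] exI[of _ "\<lambda>_. 0"], simp)
  then show ?thesis using that by blast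
qed

section \<open>The partial derivatives as derivations\<close>

lemma deriv_x_add: "deriv_x (F + G) = deriv_x F + deriv_x G"
  by (simp add: deriv_x_def pderiv_add)

lemma deriv_x_mult: "deriv_x (F * G) = F * deriv_x G + G * deriv_x F"
  by (simp add: deriv_x_def pderiv_mult)

lemma deriv_c_pCons: "deriv_c (pCons a F) = pCons (pderiv a) (deriv_c F)"
  by (simp add: deriv_c_def map_poly_pCons)

lemma deriv_c_0 [simp]: "deriv_c 0 = 0"
  by (simp add: deriv_c_def)

lemma deriv_c_add: "deriv_c (F + G) = deriv_c F + deriv_c G"
  by (rule poly_eqI) (simp add: deriv_c_def coeff_map_poly pderiv_add)

lemma deriv_c_smult: "deriv_c (smult a F) = smult (pderiv a) F + smult a (deriv_c F)"
  by (rule poly_eqI) (simp add: deriv_c_def coeff_map_poly pderiv_mult algebra_simps)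

lemma deriv_c_mult: "deriv_c (F * G) = F * deriv_c G + G * deriv_c F"
proof (induction F)
  case (pCons a F)
  show ?case
    by (simp add: deriv_c_add deriv_c_smult deriv_c_pCons pCons.IH algebra_simps)
qed simp

text \<open>The singularity argument needs only additivity and the Leibniz rule, so one proof covers
  both entries of the Jacobian matrix.\<close>

locale derivation =
  fixes D :: "'a :: comm_ring_1 \<Rightarrow> 'a"
  assumes add: "D (x + y) = D x + D y"
    and mult: "D (x * y) = x * D y + y * D x"
begin

lemma zero [simp]: "D 0 = 0"
  using add[of 0 0] by simp

lemma one [simp]: "D 1 = 0"
  using mult[of 1 1] by simp

lemma uminus: "D (- x) = - D x"
  using add[of x "- x"] by (simp add: add_eq_0_iff)

lemma diff: "D (x - y) = D x - D y"
  using add[of x "- y"] by (simp add: uminus)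

lemma of_nat [simp]: "D (of_nat k) = 0"
  by (induction k) (simp_all add: add)

lemma dvd_two_square: "2 dvd D (x\<^sup>2)"
  by (simp add: power2_eq_square mult mult_2 [symmetric])

end

interpretation deriv_x: derivation deriv_x
  by standard (simp_all add: deriv_x_add deriv_x_mult)

interpretation deriv_c: derivation deriv_c
  by standard (simp_all add: deriv_c_add deriv_c_mult)

text \<open>
  The recursion for \<open>W\<close> is the one satisfied by \<open>(g\<^sup>j - x) / (g - x)\<close> for \<open>g = x + h\<close>, with
  \<open>h'\<close>, \<open>k\<close> the first two Taylor coefficients of \<open>h\<close>.
\<close>

lemma (in class_prime_ideal) quotient_recursion_mod:
  fixes W :: "nat \<Rightarrow> 'a" and D :: "'a \<Rightarrow> 'a"
  assumes W0: "W 0 = 0"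
    and rec: "\<And>j. W (Suc j) = W j + 1 + W j * h' + h * (W j)\<^sup>2 * k + h\<^sup>2 * R j"
    and h: "h \<in> P" and h': "h' \<in> P"
  shows "W j - of_nat j \<in> P"
    and "derivation D \<Longrightarrow>
      D (W j) - (of_nat (\<Sum>i<j. i) * D h' + of_nat (\<Sum>i<j. i\<^sup>2) * k * D h) \<in> P"
proof -
  show W: "W j - of_nat j \<in> P" for j
  proof (induction j)
    case (Suc j)
    have eq: "W (Suc j) - of_nat (Suc j) =
        (W j - of_nat j) + W j * h' + h * ((W j)\<^sup>2 * k + h * R j)"
      by (simp add: rec algebra_simps power2_eq_square)
    show ?case unfolding eq using Suc h h' by (simp add: mems)
  qed (simp add: W0)
  assume "derivation D"
  then interpret D: derivation D .
  show "D (W j) - (of_nat (\<Sum>i<j. i) * D h' + of_nat (\<Sum>i<j. i\<^sup>2) * k * D h) \<in> P"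
  proof (induction j)
    case (Suc j)
    let ?S = "\<lambda>j. of_nat (\<Sum>i<j. i) * D h' + of_nat (\<Sum>i<j. i\<^sup>2) * k * D h"
    \<comment> \<open>Modulo \<open>h\<close> and \<open>h'\<close>, and with \<open>W j\<close>
      replaced by \<open>j\<close>, differentiating the recursion adds
      \<open>j * D h' + j\<^sup>2 * k * D h\<close>; this is the origin of the two power
      sums.\<close>
    have eq: "D (W (Suc j)) - ?S (Suc j) = (D (W j) - ?S j) + (W j - of_nat j) * D h' + h' * D (W j)
        + (W j - of_nat j) * ((W j + of_nat j) * k * D h) + h * D ((W j)\<^sup>2 * k)
        + h * (h * D (R j) + D h * R j + D h * R j)"
      by (simp add: rec D.add D.mult algebra_simps power2_eq_square)
    show ?case unfolding eq using Suc h h' W[of j] by (simp add: mems)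
  qed (simp add: W0)
qed

subsection \<open>Iterates of the unicritical polynomial\<close>

text \<open>Substitution of x - x^m for c, a ring homomorphism to Z[x], along which prime ideals of
  Z[x] pull back to points of the plane on the curve of fixed points.\<close>

definition fixed_curve_eval :: "nat \<Rightarrow> int poly poly \<Rightarrow> int poly" where
  "fixed_curve_eval m F =
     poly (map_poly (\<lambda>a. pcompose a ([:0, 1:] - [:0, 1:] ^ m)) F) [:0, 1:]"

lemma fixed_curve_eval_0 [simp]: "fixed_curve_eval m 0 = 0"
  by (simp add: fixed_curve_eval_def)

lemma fixed_curve_eval_pCons:
  "fixed_curve_eval m (pCons a F) =
     pcompose a ([:0, 1:] - [:0, 1:] ^ m) + [:0, 1:] * fixed_curve_eval m F"
  by (simp add: fixed_curve_eval_def map_poly_pCons)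

lemma fixed_curve_eval_add:
  "fixed_curve_eval m (F + G) = fixed_curve_eval m F + fixed_curve_eval m G"
proof -
  have "map_poly f (F + G) = map_poly f F + map_poly f G"
    if "f = (\<lambda>a. pcompose a ([:0, 1:] - [:0, 1:] ^ m))" for f :: "int poly \<Rightarrow> int poly"
    by (rule poly_eqI) (simp add: coeff_map_poly pcompose_add that)
  then show ?thesis by (simp add: fixed_curve_eval_def)
qed

lemma fixed_curve_eval_smult:
  "fixed_curve_eval m (smult a F) =
     pcompose a ([:0, 1:] - [:0, 1:] ^ m) * fixed_curve_eval m F"
  by (induction F) (simp_all add: fixed_curve_eval_pCons pcompose_mult algebra_simps)

lemma fixed_curve_eval_mult:
  "fixed_curve_eval m (F * G) = fixed_curve_eval m F * fixed_curve_eval m G"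
  by (induction F)
    (simp_all add: fixed_curve_eval_pCons fixed_curve_eval_add fixed_curve_eval_smult
      distrib_right mult.assoc)

lemma fixed_curve_eval_1 [simp]: "fixed_curve_eval m 1 = 1"
  by (subst one_pCons) (simp add: fixed_curve_eval_pCons pcompose_1)

lemma fixed_curve_eval_uminus: "fixed_curve_eval m (- F) = - fixed_curve_eval m F"
  using fixed_curve_eval_add[of m F "- F"] by (simp add: add_eq_0_iff)

lemma fixed_curve_eval_diff:
  "fixed_curve_eval m (F - G) = fixed_curve_eval m F - fixed_curve_eval m G"
  using fixed_curve_eval_add[of m F "- G"] by (simp add: fixed_curve_eval_uminus)

lemma fixed_curve_eval_power: "fixed_curve_eval m (F ^ k) = fixed_curve_eval m F ^ k"
  by (induction k) (simp_all add: fixed_curve_eval_mult)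

lemma fixed_curve_eval_of_nat [simp]: "fixed_curve_eval m (of_nat k) = of_nat k"
  by (induction k) (simp_all add: fixed_curve_eval_add)

lemma fixed_curve_eval_var_x [simp]: "fixed_curve_eval m var_x = [:0, 1:]"
  by (simp add: var_x_def fixed_curve_eval_pCons pcompose_1 flip: one_pCons)

lemma fixed_curve_eval_var_c [simp]: "fixed_curve_eval m var_c = [:0, 1:] - [:0, 1:] ^ m"
  by (simp add: var_c_def fixed_curve_eval_pCons pcompose_pCons)

lemma unicritical_iter_0 [simp]: "unicritical_iter m 0 = var_x"
  by (simp add: unicritical_iter_def)

lemma pcompose_power_left: "pcompose (F ^ k) G = pcompose F G ^ k"
  for F :: "'a :: comm_ring_1 poly"
  by (induction k) (simp_all add: pcompose_mult pcompose_1)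

lemma unicritical_iter_Suc:
  "unicritical_iter m (Suc n) = unicritical_iter m n ^ m + var_c"
  by (simp add: unicritical_iter_def unicritical_def pcompose_add pcompose_power_left)
    (simp add: var_x_def var_c_def pcompose_pCons)

lemma unicritical_iter_add:
  "unicritical_iter m (a + b) = pcompose (unicritical_iter m a) (unicritical_iter m b)"
proof (induction a)
  case 0
  show ?case by (simp add: var_x_def pcompose_pCons)
next
  case (Suc a)
  have "pcompose var_c F = var_c" for F by (simp add: var_c_def pcompose_pCons)
  then show ?case
    by (simp add: unicritical_iter_Suc pcompose_add pcompose_power_left Suc)
qed

lemma unicritical_iter_monic:
  assumes "m \<ge> 2"
  shows "lead_coeff (unicritical_iter m n) = 1" "degree (unicritical_iter m n) = m ^ n"
proof -
  have "lead_coeff (unicritical_iter m n) = 1 \<and> degree (unicritical_iter m n) = m ^ n"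
  proof (induction n)
    case 0
    show ?case by (simp add: var_x_def)
  next
    case (Suc n)
    let ?g = "unicritical_iter m n ^ m"
    have nz: "unicritical_iter m n \<noteq> 0" using Suc by auto
    have g: "degree ?g = m ^ Suc n" "lead_coeff ?g = 1"
      using Suc nz by (simp add: degree_power_eq, metis lead_coeff_power power_one)
    then have "degree var_c < degree ?g" using assms by (simp add: var_c_def)
    then show ?case
      using g unfolding unicritical_iter_Suc
      by (metis add.commute degree_add_eq_left lead_coeff_add_le)
  qed
  then show "lead_coeff (unicritical_iter m n) = 1" "degree (unicritical_iter m n) = m ^ n"
    by auto
qed

lemma Psi_0 [simp]: "Psi m 0 = 0"
  by (simp add: Psi_def)

lemma Psi_monic:
  assumes "m \<ge> 2" "n > 0"
  shows "lead_coeff (Psi m n) = 1" and "degree (Psi m n) > 0"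
proof -
  let ?f = "unicritical_iter m n"
  have "degree ?f > 1"
    using assms one_less_power[of m n] by (simp add: unicritical_iter_monic)
  then have deg: "degree (- var_x) < degree ?f" by (simp add: var_x_def)
  show "lead_coeff (Psi m n) = 1"
    using lead_coeff_add_le[OF deg] unicritical_iter_monic(1)[OF assms(1), of n]
    by (simp add: Psi_def)
  show "degree (Psi m n) > 0"
    using degree_add_eq_left[OF deg] deg by (simp add: Psi_def)
qed

lemma Psi_nonzero: "m \<ge> 2 \<Longrightarrow> n > 0 \<Longrightarrow> Psi m n \<noteq> 0"
  using Psi_monic(2)[of m n] by auto

lemma deriv_x_var_x [simp]: "deriv_x var_x = 1"
  by (simp add: deriv_x_def var_x_def pderiv_pCons)

text \<open>The chain rule along the orbit, kept as a product because it is read in three ways: as a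
  multiple of \<open>m\<close>, as a power of the multiplier on the fixed curve, and, for odd
  \<open>m\<close>, as a constant times a square.\<close>

lemma deriv_x_unicritical_iter:
  "deriv_x (unicritical_iter m n) = (\<Prod>i<n. of_nat m * unicritical_iter m i ^ (m - 1))"
proof (induction n)
  case (Suc n)
  have "deriv_x (unicritical_iter m (Suc n)) =
      deriv_x (unicritical_iter m n) * (of_nat m * unicritical_iter m n ^ (m - 1))"
    by (simp add: unicritical_iter_Suc deriv_x_add)
      (simp add: deriv_x_def var_c_def pderiv_pCons pderiv_power of_nat_poly mult.commute)
  then show ?case by (simp add: Suc)
qed simp

lemma deriv_x_Psi: "deriv_x (Psi m n) = deriv_x (unicritical_iter m n) - 1"
  by (simp add: Psi_def deriv_x.diff)

definition fixed_multiplier :: "nat \<Rightarrow> int poly" where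
  "fixed_multiplier m = of_nat m * [:0, 1:] ^ (m - 1)"

lemma fixed_curve_eval_unicritical_iter [simp]:
  "fixed_curve_eval m (unicritical_iter m n) = [:0, 1:]"
  by (induction n)
    (simp_all add: unicritical_iter_Suc fixed_curve_eval_add fixed_curve_eval_power)

lemma fixed_curve_eval_Psi [simp]: "fixed_curve_eval m (Psi m n) = 0"
  by (simp add: Psi_def fixed_curve_eval_diff)

lemma fixed_curve_eval_deriv_x_Psi:
  "fixed_curve_eval m (deriv_x (Psi m n)) = fixed_multiplier m ^ n - 1"
proof -
  have "fixed_curve_eval m (\<Prod>i<n. of_nat m * unicritical_iter m i ^ (m - 1)) =
      fixed_multiplier m ^ n"
    by (induction n)
      (simp_all add: fixed_multiplier_def fixed_curve_eval_mult fixed_curve_eval_power)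
  then show ?thesis
    by (simp add: deriv_x_Psi deriv_x_unicritical_iter fixed_curve_eval_diff)
qed

section \<open>Congruences and quotients among the \<open>Psi m n\<close>\<close>

lemma unicritical_iter_eq: "unicritical_iter m n = [:0, 1:] + Psi m n"
  by (simp add: Psi_def var_x_def)

text \<open>Modulo \<open>Psi m b\<close> the \<open>b\<close>-th iterate is x, so composing with it
  changes nothing.\<close>

lemma Psi_add_cong: "Psi m b dvd Psi m (a + b) - Psi m a"
proof -
  let ?h = "Psi m b"
  obtain G R where "\<And>Y. pcompose (unicritical_iter m a) ([:0, 1:] + Y) = unicritical_iter m a
      + Y * pderiv (unicritical_iter m a) + Y\<^sup>2 * G + Y ^ 3 * R Y"
    using pcompose_add_X_Taylor by blast
  then have "Psi m (a + b) - Psi m a =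
      ?h * (pderiv (unicritical_iter m a) + ?h * G + ?h\<^sup>2 * R ?h)"
    by (simp add: Psi_def[of m "a + b"] Psi_def[of m a] unicritical_iter_add[of m a b]
        unicritical_iter_eq[of m b] power2_eq_square power3_eq_cube algebra_simps)
  then show ?thesis by simp
qed

text \<open>With h = Psi_q, the iterate of order jq is x + h W_j. Applying f^q = x + h to it gives x
  + h W_j + h(x + h W_j); subtracting x and dividing the Taylor expansion by h yields the
  recursion.\<close>

lemma Psi_quotients:
  obtains W G R where "W 0 = 0"
    and "\<And>j. W (Suc j) = W j + 1 + W j * deriv_x (Psi m q)
           + Psi m q * (W j)\<^sup>2 * G + (Psi m q)\<^sup>2 * R j"
    and "\<And>j. Psi m (j * q) = Psi m q * W j"
proof -
  define h where "h = Psi m q"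
  obtain G R where Taylor: "\<And>Y. pcompose h ([:0, 1:] + Y) = h + Y * pderiv h + Y\<^sup>2 * G + Y ^ 3 * R Y"
    using pcompose_add_X_Taylor by blast
  define W where "W = rec_nat 0 (\<lambda>_ w. w + 1 + w * deriv_x h + h * w\<^sup>2 * G + h\<^sup>2 * (w ^ 3 * R (h * w)))"
  have W: "W 0 = 0"
    "W (Suc j) = W j + 1 + W j * deriv_x h + h * (W j)\<^sup>2 * G + h\<^sup>2 * (W j ^ 3 * R (h * W j))" for j
    by (simp_all add: W_def)
  have "Psi m (j * q) = h * W j" for j
  proof (induction j)
    case (Suc j)
    have eq: "unicritical_iter m q = [:0, 1:] + h"
      "unicritical_iter m (j * q) = [:0, 1:] + h * W j"
      by (simp_all add: unicritical_iter_eq h_def[symmetric] Suc)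
    have "unicritical_iter m (Suc j * q) = ([:0, 1:] + h * W j) + pcompose h ([:0, 1:] + h * W j)"
      by (simp add: unicritical_iter_add eq pcompose_add pcompose_pCons)
    also have "\<dots> = [:0, 1:] + h * W (Suc j)"
      unfolding Taylor W(2)
      by (simp add: deriv_x_def power2_eq_square power3_eq_cube algebra_simps)
    finally show ?case by (simp add: Psi_def var_x_def)
  qed (simp add: W)
  then show ?thesis using that[of W G "\<lambda>j. W j ^ 3 * R (h * W j)"] W unfolding h_def by blast
qed

lemma Psi_dvd_Psi: "k dvd l \<Longrightarrow> Psi m k dvd Psi m l"
  by (metis Psi_quotients dvd_def dvd_triv_left mult.commute)

text \<open>Both \<open>Psi m l\<close> and \<open>Psi m k\<close> vanish on the fixed curve, so
  their quotient is read off after differentiating in x, as in l'Hopital's rule.\<close>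

lemma fixed_curve_eval_Psi_quotient:
  assumes "Psi m l = Psi m k * U"
  shows "fixed_multiplier m ^ l - 1 = (fixed_multiplier m ^ k - 1) * fixed_curve_eval m U"
proof -
  have "fixed_curve_eval m (deriv_x (Psi m l)) = fixed_curve_eval m (deriv_x (Psi m k * U))"
    by (simp add: assms)
  then show ?thesis
    by (simp add: fixed_curve_eval_deriv_x_Psi deriv_x_mult fixed_curve_eval_add fixed_curve_eval_mult)
qed

subsection \<open>The dynatomic polynomial exists\<close>

lemma moebius_mu_range: "moebius_mu k \<in> {-1, 0, 1}"
  by (cases "even (card (prime_factors k))") (simp_all add: moebius_mu_def)

lemma prod_powi_sign:
  fixes F :: "'a \<Rightarrow> 'b :: field" and s :: "'a \<Rightarrow> int"
  assumes "finite A" "\<And>a. a \<in> A \<Longrightarrow> s a \<in> {-1, 0, 1}"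
  shows "(\<Prod>a\<in>A. F a powi s a) = prod F {a \<in> A. s a = 1} / prod F {a \<in> A. s a = -1}"
proof -
  have "(\<Prod>a\<in>A. F a powi s a) =
      (\<Prod>a\<in>A. (if s a = 1 then F a else 1) / (if s a = -1 then F a else 1))"
    using assms(2) by (intro prod.cong) (force simp: power_int_minus divide_inverse)+
  also have "\<dots> = (\<Prod>a\<in>A. if s a = 1 then F a else 1) / (\<Prod>a\<in>A. if s a = -1 then F a else 1)"
    by (rule prod_dividef)
  finally show ?thesis
    using assms(1) by (simp add: prod.inter_filter)
qed

lemma sum_sign:
  fixes s :: "'a \<Rightarrow> int"
  assumes "finite A" "\<And>a. a \<in> A \<Longrightarrow> s a \<in> {-1, 0, 1}"
  shows "sum s A = int (card {a \<in> A. s a = 1}) - int (card {a \<in> A. s a = -1})"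
proof -
  have "sum s A = (\<Sum>a\<in>A. (if s a = 1 then 1 else 0) - (if s a = -1 then 1 else 0))"
    using assms(2) by (intro sum.cong) force+
  also have "\<dots> = (\<Sum>a\<in>A. if s a = 1 then 1 else 0) - (\<Sum>a\<in>A. if s a = -1 then 1 else 0)"
    by (rule sum_subtractf)
  also have "\<dots> = int (card {a \<in> A. s a = 1}) - int (card {a \<in> A. s a = -1})"
    using assms(1) by (simp flip: sum.inter_filter)
  finally show ?thesis .
qed

text \<open>The sum of mu(n/d) over these \<open>d\<close> is a Moebius sum over the divisors of
  n/k, hence 0 or 1. The cardinalities will be multiplicities of a prime in the denominator and
  numerator of the Moebius product.\<close>

lemma card_moebius_mu_le:
  fixes n k :: nat
  assumes n: "n > 0" and k: "k dvd n"
  shows "card {d. d dvd n \<and> k dvd d \<and> moebius_mu (n div d) = -1}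
    \<le> card {d. d dvd n \<and> k dvd d \<and> moebius_mu (n div d) = 1}"
proof -
  let ?A = "{d. d dvd n \<and> k dvd d}"
  have "(\<Sum>d\<in>?A. moebius_mu (n div d)) = (\<Sum>D | D dvd n div k. moebius_mu D)"
    by (rule sum.reindex_bij_witness[of _ "\<lambda>d. n div d" "\<lambda>d. n div d"])
      (use n k in \<open>auto elim!: dvdE simp: dvd_div_iff_mult\<close>)
  also have "\<dots> \<ge> 0"
  proof (cases "n div k = 1")
    case False
    moreover have "n div k > 0" using n k by (auto elim!: dvdE)
    ultimately show ?thesis using sum_moebius_mu_eq_0[of "n div k"] by simp
  qed simp
  finally have "(\<Sum>d\<in>?A. moebius_mu (n div d)) \<ge> 0" .
  moreover have "finite ?A" using n by simp
  ultimately show ?thesis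
    using moebius_mu_range by (subst (asm) sum_sign) (auto simp: conj_assoc)
qed

section \<open>Multiplicities of prime elements in \<open>Psi m n\<close>\<close>

lemma prime_elem_dvd_monic:
  fixes F C :: "'a :: {idom_divide, algebraic_semidom} poly"
  assumes "C dvd F" "lead_coeff F = 1" "prime_elem C"
  shows "is_unit (lead_coeff C)" and "degree C > 0"
proof -
  show lc: "is_unit (lead_coeff C)" using assms(1,2) by (metis dvd_def lead_coeff_mult)
  show "degree C > 0"
  proof (rule ccontr)
    assume "\<not> ?thesis"
    then obtain u where "C = [:u:]" by (metis degree_eq_zeroE not_gr_zero)
    then show False using lc assms(3) by (auto simp: prime_elem_def is_unit_const_poly_iff)
  qed
qed

text \<open>Modulo any prime divisor of \<open>m\<close>, the \<open>x\<close>-derivative of \<open>Psi m n\<close> is the constant \<open>-1\<close>.\<close>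

lemma Psi_not_dvd_square:
  assumes m: "m \<ge> 2" and n: "n > 0" and pr: "prime_elem \<pi>"
  shows "\<not> \<pi>\<^sup>2 dvd Psi m n"
proof
  assume "\<pi>\<^sup>2 dvd Psi m n"
  then obtain B where "Psi m n = \<pi>\<^sup>2 * B" by blast
  then have B: "Psi m n = \<pi> * (\<pi> * B)" by (simp add: power2_eq_square mult.assoc)
  define E where "E = deriv_x (\<pi> * B) + B * deriv_x \<pi>"
  have E: "deriv_x (Psi m n) = \<pi> * E"
    by (simp only: B deriv_x_mult[of \<pi> "\<pi> * B"] E_def distrib_left mult.assoc)
  obtain l where l: "prime l" "l dvd m" using m prime_factor_nat[of m] by auto
  have "of_nat l dvd (of_nat m :: int poly poly)" using l by (auto elim: dvdE)
  also have "of_nat m dvd deriv_x (unicritical_iter m n)"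
    unfolding deriv_x_unicritical_iter
    using n by (subst prod.remove[of _ 0]) (simp_all add: mult.assoc)
  also have "\<dots> = 1 + \<pi> * E" using E by (simp add: deriv_x_Psi algebra_simps)
  \<comment> \<open>So \<open>- E\<close> inverts \<pi> modulo \<open>l\<close>; but a prime factor
    of a monic polynomial has positive degree and unit leading coefficient, hence is no unit modulo
    \<open>l\<close>.\<close>
  finally have "of_nat l dvd - (1 + \<pi> * E)" by (simp only: dvd_minus_iff)
  also have "- (1 + \<pi> * E) = \<pi> * (- E) - 1" by simp
  finally have "[:[:int l:]:] dvd \<pi> * (- E) - 1" by (simp only: of_nat_poly of_nat_id)
  moreover have "\<pi> dvd Psi m n" by (simp add: B)
  note \<pi> = prime_elem_dvd_monic[OF this Psi_monic(1)[OF m n] pr]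
  have l': "prime_elem [:int l:]" using l by (simp add: prime_elem_const_poly_iff)
  moreover have "\<not> [:int l:] dvd lead_coeff \<pi>"
    using \<pi>(1) l' by (meson dvd_trans prime_elem_def)
  ultimately show False using prime_dvd_all_coeffs_of_unit \<pi>(2) by blast
qed

lemma multiplicity_Psi:
  assumes "m \<ge> 2" "n > 0" "prime_elem \<pi>"
  shows "multiplicity \<pi> (Psi m n) = (if \<pi> dvd Psi m n then 1 else 0)"
  using Psi_not_dvd_square[OF assms]
  by (auto intro!: multiplicity_eqI simp: power2_eq_square not_dvd_imp_multiplicity_0)

lemma multiplicity_prod_Psi:
  assumes m: "m \<ge> 2" and A: "finite A" "0 \<notin> A" and pr: "prime_elem \<pi>"
  shows "multiplicity \<pi> (\<Prod>d\<in>A. Psi m d) = card {d \<in> A. \<pi> dvd Psi m d}"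
proof -
  have pos: "d > 0" if "d \<in> A" for d using A that by (metis not_gr_zero)
  have "multiplicity \<pi> (\<Prod>d\<in>A. Psi m d) = (\<Sum>d\<in>A. multiplicity \<pi> (Psi m d))"
    using A pr Psi_nonzero[OF m] pos by (intro prime_elem_multiplicity_prod_distrib) force+
  also have "\<dots> = (\<Sum>d\<in>A. if \<pi> dvd Psi m d then 1 else 0)"
    using multiplicity_Psi[OF m _ pr] pos by (intro sum.cong) auto
  also have "\<dots> = card {d \<in> A. \<pi> dvd Psi m d}"
    using A by (simp flip: sum.inter_filter)
  finally show ?thesis .
qed

text \<open>\<open>k\<close> is the period of x under f_c modulo \<pi>.\<close>

lemma prime_elem_dvd_Psi_multiples:
  fixes n :: nat
  assumes n: "n > 0" and ex: "\<exists>d. d dvd n \<and> \<pi> dvd Psi m d"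
  obtains k where "k dvd n" "\<And>d. d dvd n \<Longrightarrow> \<pi> dvd Psi m d \<longleftrightarrow> k dvd d"
proof -
  define S where "S = {d. \<pi> dvd Psi m d}"
  have shift: "a + b \<in> S \<longleftrightarrow> a \<in> S" if "b \<in> S" for a b
  proof -
    have "\<pi> dvd Psi m (a + b) - Psi m a"
      using that Psi_add_cong unfolding S_def by (blast intro: dvd_trans)
    from dvd_add_right_iff[OF this, of "Psi m a"] show ?thesis by (simp add: S_def)
  qed
  define k where "k = (LEAST d. d dvd n \<and> d \<in> S)"
  have k: "k dvd n" "k \<in> S"
    using LeastI_ex[of "\<lambda>d. d dvd n \<and> d \<in> S"] ex by (auto simp: k_def S_def)
  have "d \<in> S \<longleftrightarrow> k dvd d" if d: "d dvd n" for d
  proof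
    assume "d \<in> S"
    then have "gcd k d \<in> S" using gcd_mem_shift_closed[OF shift] k by blast
    moreover have "gcd k d dvd n" using d by (meson dvd_trans gcd_dvd2)
    ultimately have "k \<le> gcd k d" unfolding k_def by (intro Least_le) auto
    moreover have "k > 0" using k(1) n by (auto elim: dvdE)
    ultimately have "gcd k d = k"
      by (meson dvd_imp_le gcd_dvd1 le_antisym)
    then show "k dvd d" by (metis gcd_dvd2)
  next
    assume "k dvd d"
    then show "d \<in> S" using k(2) Psi_dvd_Psi unfolding S_def by (metis dvd_trans mem_Collect_eq)
  qed
  then show ?thesis using that k(1) by (auto simp: S_def)
qed

lemma to_fract_prod: "to_fract (prod f A) = (\<Prod>a\<in>A. to_fract (f a))"
  by (induction A rule: infinite_finite_induct) simp_all

text \<open>This discharges the \<open>THE\<close>. Each prime has multiplicity 0 or 1 in every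
  factor, so its multiplicities in numerator and denominator are the counts compared in
  \<open>card_moebius_mu_le\<close>.\<close>

lemma to_fract_dynatomic:
  assumes m: "m \<ge> 2" and n: "n > 0"
  shows "to_fract (dynatomic m n) =
    (\<Prod>d | d dvd n. to_fract (Psi m d) powi moebius_mu (n div d))"
proof -
  define A where "A s = {d \<in> {d. d dvd n}. moebius_mu (n div d) = s}" for s
  have A: "finite (A s)" "0 \<notin> A s" for s
    using n by (auto simp: A_def)
  have Psi_A: "Psi m d \<noteq> 0" if "d \<in> A s" for d s
    using that A(2)[of s] Psi_nonzero[OF m, of d] by (cases "d = 0") auto
  have "(\<Prod>d\<in>A (-1). Psi m d) dvd (\<Prod>d\<in>A 1. Psi m d)"
  proof (rule multiplicity_le_imp_dvd)
    show "(\<Prod>d\<in>A (-1). Psi m d) \<noteq> 0"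
      using A(1) Psi_A by (simp add: prod_zero_iff)
    fix \<pi> :: "int poly poly"
    assume "prime \<pi>"
    then have pr: "prime_elem \<pi>" by simp
    show "multiplicity \<pi> (\<Prod>d\<in>A (-1). Psi m d) \<le> multiplicity \<pi> (\<Prod>d\<in>A 1. Psi m d)"
    proof (cases "\<exists>d. d dvd n \<and> \<pi> dvd Psi m d")
      case True
      then obtain k where k: "k dvd n" "\<And>d. d dvd n \<Longrightarrow> \<pi> dvd Psi m d \<longleftrightarrow> k dvd d"
        using prime_elem_dvd_Psi_multiples[OF n] by blast
      have "{d \<in> A s. \<pi> dvd Psi m d} = {d. d dvd n \<and> k dvd d \<and> moebius_mu (n div d) = s}" for s
        using k(2) by (auto simp: A_def)
      then show ?thesis
        using card_moebius_mu_le[OF n k(1)] by (simp add: multiplicity_prod_Psi m A pr)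
    next
      case False
      then have "{d \<in> A (-1). \<pi> dvd Psi m d} = {}" by (auto simp: A_def)
      then have "multiplicity \<pi> (\<Prod>d\<in>A (-1). Psi m d) = 0"
        by (simp only: multiplicity_prod_Psi[OF m A pr] card.empty)
      then show ?thesis by simp
    qed
  qed
  then obtain F where F: "(\<Prod>d\<in>A 1. Psi m d) = (\<Prod>d\<in>A (-1). Psi m d) * F" by blast
  have nz: "(\<Prod>d\<in>A (-1). to_fract (Psi m d)) \<noteq> 0"
    using A(1) Psi_A by (simp add: prod_zero_iff)
  have "(\<Prod>d | d dvd n. to_fract (Psi m d) powi moebius_mu (n div d)) =
      (\<Prod>d\<in>A 1. to_fract (Psi m d)) / (\<Prod>d\<in>A (-1). to_fract (Psi m d))"
    unfolding A_def using n by (intro prod_powi_sign moebius_mu_range) simp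
  also have "\<dots> = to_fract F"
    using nz arg_cong[OF F, of to_fract] by (simp add: to_fract_prod)
  finally show ?thesis
    by (simp add: dynatomic_def)
qed

subsection \<open>A point with multiplier of prescribed order\<close>

lemma (in class_prime_ideal) prod_mset_mem: "prod_mset A \<in> P \<Longrightarrow> \<exists>a. a \<in># A \<and> a \<in> P"
  by (induction A) (auto simp: one_notin dest: prime_mem)

lemma class_prime_ideal_int_poly_root:
  "class_prime_ideal {F :: int poly. poly (map_poly of_int F) (z :: complex) = 0}"
proof -
  define ev where "ev F = poly (map_poly of_int F) z" for F :: "int poly"
  have ev_pCons: "ev (pCons a F) = of_int a + z * ev F" for a F
    by (simp add: ev_def map_poly_pCons)
  have add: "ev (F + G) = ev F + ev G" for F G
  proof -
    have "map_poly of_int (F + G) = map_poly of_int F + (map_poly of_int G :: complex poly)"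
      by (rule poly_eqI) (simp add: coeff_map_poly)
    then show ?thesis by (simp add: ev_def)
  qed
  have "ev (smult a F) = of_int a * ev F" for a F
  proof -
    have "map_poly of_int (smult a F) = smult (of_int a) (map_poly of_int F :: complex poly)"
      by (rule poly_eqI) (simp add: coeff_map_poly)
    then show ?thesis by (simp add: ev_def)
  qed
  then have mult: "ev (F * G) = ev F * ev G" for F G
  proof (induction F)
    case 0
    show ?case by (simp add: ev_def)
  next
    case (pCons a F)
    then show ?case by (simp add: ev_pCons add distrib_right mult.assoc)
  qed
  have "ev 0 = 0" "ev 1 = 1" by (simp_all add: ev_def)
  then have "class_prime_ideal {F. ev F = 0}"
    by unfold_locales (auto simp: add mult)
  then show ?thesis by (simp add: ev_def)
qed

text \<open>Any irreducible factor vanishing at a primitive \<open>r\<close>-th root of unity will do.\<close>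

lemma exists_primitive_factor:
  assumes r: "r > 0"
  obtains C :: "int poly" where "prime_elem C" "C dvd [:0, 1:] ^ r - 1"
    "\<And>k. 0 < k \<Longrightarrow> k < r \<Longrightarrow> \<not> C dvd [:0, 1:] ^ k - 1"
proof -
  define z where "z = cis (2 * pi / real r)"
  define K where "K = {F :: int poly. poly (map_poly of_int F) z = 0}"
  interpret K: class_prime_ideal K
    unfolding K_def by (rule class_prime_ideal_int_poly_root)
  have mem: "[:0, 1:] ^ k - 1 \<in> K \<longleftrightarrow> z ^ k = 1" for k
  proof -
    have "([:0, 1:] ^ k :: int poly) = monom 1 k" by (simp add: monom_altdef)
    moreover have "map_poly of_int (monom 1 k - 1) = (monom 1 k - 1 :: complex poly)"
      by (rule poly_eqI) (simp add: coeff_map_poly)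
    ultimately show ?thesis by (simp add: K_def poly_monom)
  qed
  have zr: "z ^ r = 1" using r by (simp add: z_def DeMoivre)
  have zk: "z ^ k \<noteq> 1" if "0 < k" "k < r" for k
  proof
    assume "z ^ k = 1"
    moreover have "z ^ k = cis (2 * pi * real k / real r)"
      by (simp add: z_def DeMoivre mult.commute)
    ultimately have "cis (2 * pi * real k / real r) = cis (2 * pi * real 0 / real r)" by simp
    from inj_onD[OF bij_betw_imp_inj_on[OF bij_betw_roots_unity[OF r]] this] have "k = 0"
      using that r by simp
    then show False using that by simp
  qed
  let ?x = "[:0, 1:] ^ r - 1 :: int poly"
  have "degree ([:0, 1:] ^ r :: int poly) = r" by (simp add: degree_power_eq)
  then have "?x \<noteq> 0" using r by auto
  then obtain A where A: "\<And>C. C \<in># A \<Longrightarrow> prime C" "normalize (prod_mset A) = normalize ?x"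
    using prime_factorization_exists' by blast
  have "?x \<in> K" using mem zr by blast
  moreover have "?x dvd prod_mset A" "prod_mset A dvd ?x"
    using A(2) by (simp_all add: associated_iff_dvd)
  ultimately obtain C where C: "C \<in># A" "C \<in> K"
    using K.dvd_mem K.prod_mset_mem by blast
  have "C dvd ?x" using C(1) \<open>prod_mset A dvd ?x\<close> by (meson dvd_prod_mset dvd_trans)
  then show ?thesis
    using that[of C] A(1)[OF C(1)] C(2) K.dvd_mem mem zk by blast
qed

text \<open>\<open>J\<close> is a prime containing \<open>p\<close> and
  \<open>pcompose C lam\<close>, so that the multiplier becomes a root of \<open>C\<close> modulo
  \<open>J\<close>. It exists because the leading coefficient of \<open>pcompose C lam\<close> is a
  unit times a power of \<open>m\<close>, hence prime to \<open>p\<close>.\<close>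

lemma exists_place_with_multiplier_order:
  fixes m p r :: nat
  assumes m: "m \<ge> 2" and p: "prime p" "\<not> p dvd m" and r: "r > 0" "\<not> p dvd r"
  obtains J where "class_prime_ideal J" "of_nat p \<in> J"
    "\<And>k. fixed_multiplier m ^ k - 1 \<in> J \<longleftrightarrow> r dvd k"
proof -
  define X :: "int poly" where "X = [:0, 1:]"
  define lam where "lam = fixed_multiplier m"
  have lam: "lam = monom (int m) (m - 1)"
    by (simp add: lam_def fixed_multiplier_def of_nat_poly monom_altdef)
  have lam_deg: "degree lam = m - 1" "lead_coeff lam = int m"
    using m by (simp_all add: lam degree_monom_eq)
  obtain C where C: "prime_elem C" "C dvd X ^ r - 1"
    "\<And>k. 0 < k \<Longrightarrow> k < r \<Longrightarrow> \<not> C dvd X ^ k - 1"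
    using exists_primitive_factor[OF r(1)] unfolding X_def by metis
  have monic: "lead_coeff (X ^ r - 1) = 1"
  proof -
    have "degree (- 1 :: int poly) < degree (X ^ r)" using r by (simp add: X_def degree_power_eq)
    from lead_coeff_add_le[OF this] show ?thesis by (simp add: X_def lead_coeff_power)
  qed
  have C': "is_unit (lead_coeff C)" "degree C > 0"
    using prime_elem_dvd_monic[OF C(2) monic C(1)] by auto
  have comp: "pcompose (X ^ k - 1) lam = lam ^ k - 1" for k
    by (simp add: X_def pcompose_diff pcompose_power_left pcompose_pCons pcompose_1)
  have p': "prime_elem (int p)" using p by simp
  have "degree (pcompose C lam) > 0" using C' m by (simp add: lam_deg degree_pcompose)
  moreover have "\<not> int p dvd lead_coeff (pcompose C lam)"
  proof
    assume "int p dvd lead_coeff (pcompose C lam)"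
    then have "int p dvd lead_coeff C * int m ^ degree C"
      using m lam_deg by (simp add: lead_coeff_comp)
    then have "int p dvd lead_coeff C \<or> int p dvd int m"
      using p' by (metis prime_elem_dvd_mult_iff prime_elem_dvd_power)
    moreover have "\<not> int p dvd lead_coeff C" using C'(1) p' by (meson dvd_trans prime_elem_def)
    ultimately show False using p by simp
  qed
  ultimately have proper: "\<not> [:int p:] dvd pcompose C lam * v - 1" for v
    using prime_dvd_all_coeffs_of_unit p' by blast
  have "u * of_nat p + v * pcompose C lam \<noteq> 1" for u v
  proof
    assume "u * of_nat p + v * pcompose C lam = 1"
    then have "pcompose C lam * v - 1 = [:int p:] * (- u)"
      by (simp add: of_nat_poly algebra_simps)
    then show False using proper by (metis dvd_triv_left)
  qed
  then obtain J where "class_prime_ideal J" and J: "of_nat p \<in> J" "pcompose C lam \<in> J"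
    using exists_prime_ideal by blast
  then interpret J: class_prime_ideal J by simp
  define S where "S = {k. lam ^ k - 1 \<in> J}"
  have shift: "a + b \<in> S \<longleftrightarrow> a \<in> S" if "b \<in> S" for a b
  proof -
    have "(lam ^ (a + b) - 1) - (lam ^ a - 1) = lam ^ a * (lam ^ b - 1)"
      by (simp add: power_add algebra_simps)
    then have "(lam ^ (a + b) - 1) - (lam ^ a - 1) \<in> J"
      using that by (simp only: S_def mem_Collect_eq J.mult_mem)
    then show ?thesis using J.mem_cong by (simp only: S_def mem_Collect_eq)
  qed
  have rS: "r \<in> S"
  proof -
    obtain E where "X ^ r - 1 = C * E" using C(2) by blast
    then have "lam ^ r - 1 = pcompose C lam * pcompose E lam"
      by (metis comp pcompose_mult)
    then show ?thesis using J J.mult_mem' by (simp add: S_def)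
  qed
  have "r dvd k" if "k \<in> S" for k
  proof (rule ccontr)
    assume nd: "\<not> r dvd k"
    define d where "d = gcd k r"
    have d: "d \<in> S" unfolding d_def by (rule gcd_mem_shift_closed[OF shift that rS])
    have "d dvd r" "d \<noteq> r" using nd unfolding d_def by (simp, metis gcd_dvd1)
    then obtain e where e: "r = d * e" by blast
    have "0 < d" using r(1) by (simp add: d_def)
    moreover have "d < r" using dvd_imp_le[OF \<open>d dvd r\<close> r(1)] \<open>d \<noteq> r\<close> by linarith
    ultimately have d': "0 < d" "d < r" by blast+
    \<comment> \<open>Both factors of X^r - 1 = (X^d - 1) Q vanish at \<open>lam\<close>, which
      makes it a double root; yet the derivative r X^(r-1) is nonzero there, as \<open>p\<close>
      does not divide \<open>r\<close> and \<open>lam\<close> is invertible modulo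
      \<open>J\<close>.\<close>
    define Q where "Q = (\<Sum>i<e. (X ^ d) ^ i)"
    have Q: "X ^ r - 1 = (X ^ d - 1) * Q"
      by (simp add: e power_mult power_diff_1_eq[of "X ^ d"] Q_def)
    then have "C dvd Q" using C d' by (metis prime_elem_dvd_mult_iff)
    then obtain Q' where "Q = C * Q'" by blast
    then have QJ: "pcompose Q lam \<in> J"
      using J(2) by (simp add: pcompose_mult J.mult_mem')
    have "pderiv (X ^ r - 1) = of_nat r * X ^ (r - 1)"
      by (simp add: X_def pderiv_diff pderiv_power pderiv_pCons of_nat_poly)
    then have "of_nat r * lam ^ (r - 1) = pcompose (pderiv ((X ^ d - 1) * Q)) lam"
      unfolding Q[symmetric]
      by (simp add: X_def pcompose_smult pcompose_power_left pcompose_pCons of_nat_poly)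
    also have "\<dots> \<in> J"
      using QJ d by (simp add: pderiv_mult pcompose_add pcompose_mult comp S_def J.mems)
    finally have "of_nat r \<in> J \<or> lam ^ (r - 1) \<in> J" using J.prime_mem by blast
    then show False
    proof
      assume "of_nat r \<in> J"
      have "coprime r p" using p r by (simp add: prime_imp_coprime coprime_commute)
      then obtain u v where "u * int r + v * int p = 1"
        by (metis bezout_int coprime_imp_gcd_eq_1 coprime_int_iff)
      then have "of_int u * of_nat r + of_int v * of_nat p = (1 :: int poly)"
        by (metis of_int_1 of_int_add of_int_mult of_int_of_nat_eq)
      then show False using J(1) \<open>of_nat r \<in> J\<close> J.one_notin J.add_mem J.mult_mem by metis
    next
      assume "lam ^ (r - 1) \<in> J"
      then have "lam * lam ^ (r - 1) \<in> J" by (rule J.mult_mem)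
      then have "lam ^ r \<in> J" using r by (simp add: power_eq_if)
      moreover have "lam ^ r - 1 \<in> J" using rS by (simp add: S_def)
      ultimately have "lam ^ r - (lam ^ r - 1) \<in> J" by (rule J.diff_mem)
      then show False using J.one_notin by simp
    qed
  qed
  moreover have "k \<in> S" if "r dvd k" for k
  proof -
    have "k = 0 + (k div r) * r" using that by simp
    moreover have "0 \<in> S" by (simp add: S_def)
    ultimately show ?thesis
      using add_mult_mem_shift_closed[of S r 0 "k div r", OF shift rS] by simp
  qed
  ultimately show ?thesis
    using that[OF \<open>class_prime_ideal J\<close> J(1)] by (auto simp: S_def lam_def)
qed

subsection \<open>Singularity of the fibre\<close>

lemma dvd_sum_lessThan:
  fixes p :: nat
  assumes p: "prime p" "p > 2"
  shows "p dvd (\<Sum>i<p. i)"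
proof -
  have "2 * (\<Sum>i<k. i) + k = k * k" for k :: nat
    by (induction k) simp_all
  from this[of p] have "p dvd 2 * (\<Sum>i<p. i) + p" by simp
  then have "p dvd 2 * (\<Sum>i<p. i)" by simp
  moreover have "\<not> p dvd 2" using p by (auto dest: dvd_imp_le)
  ultimately show ?thesis using p prime_dvd_mult_iff by blast
qed

lemma dvd_sum_squares_lessThan:
  fixes p :: nat
  assumes p: "prime p" "p > 3"
  shows "p dvd (\<Sum>i<p. i\<^sup>2)"
proof -
  have "6 * (\<Sum>i<k. i\<^sup>2) + k * (3 * k) = k * (2 * k * k + 1)" for k :: nat
    by (induction k) (simp_all add: algebra_simps power2_eq_square)
  from this[of p] have "p dvd 6 * (\<Sum>i<p. i\<^sup>2) + p * (3 * p)" by simp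
  then have "p dvd 6 * (\<Sum>i<p. i\<^sup>2)" by (simp only: dvd_add_left_iff dvd_triv_left)
  moreover have "\<not> p dvd 2" "\<not> p dvd 3" using p by (auto dest: dvd_imp_le)
  then have "\<not> p dvd 2 * 3" using p prime_dvd_mult_iff by blast
  then have "\<not> p dvd 6" by simp
  ultimately show ?thesis using p prime_dvd_mult_iff by blast
qed

lemma class_prime_ideal_fixed_curve:
  assumes "class_prime_ideal J"
  shows "class_prime_ideal {F. fixed_curve_eval m F \<in> J}"
proof -
  interpret class_prime_ideal J by fact
  show ?thesis
    by unfold_locales
      (auto simp: fixed_curve_eval_add fixed_curve_eval_mult mems one_notin dest: prime_mem)
qed

text \<open>A point on the fixed curve over \<open>p\<close>: \<open>J\<close> is its ideal in the
  coordinate ring Z[x] of the curve, and \<open>order\<close> fixes the order of the multiplier in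
  the residue field.\<close>

locale fixed_point_place =
  fixes m p r :: nat and J :: "int poly set"
  assumes m: "m \<ge> 2" and p: "prime p" "\<not> p dvd m"
    and J: "class_prime_ideal J" and pJ: "of_nat p \<in> J"
    and order: "\<And>k. fixed_multiplier m ^ k - 1 \<in> J \<longleftrightarrow> r dvd k"
begin

definition P :: "int poly poly set" where "P = {F. fixed_curve_eval m F \<in> J}"

sublocale class_prime_ideal P
  unfolding P_def using J by (rule class_prime_ideal_fixed_curve)

lemma of_nat_mem: "p dvd k \<Longrightarrow> of_nat k \<in> P"
  using pJ J unfolding P_def
  by (auto elim!: dvdE simp: class_prime_ideal.mult_mem')

lemma Psi_mem: "Psi m k \<in> P"
  using J by (simp add: P_def class_prime_ideal.zero_mem)

lemma deriv_x_Psi_mem: "deriv_x (Psi m k) \<in> P \<longleftrightarrow> r dvd k"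
  by (simp add: P_def fixed_curve_eval_deriv_x_Psi order)

text \<open>If \<open>U\<close> vanishes at the point, the \<open>l\<close>-th power of the
  multiplier is 1 there. This keeps the denominators of Phi_n from vanishing.\<close>

lemma quotient_mem_imp_dvd:
  assumes "Psi m l = Psi m k * U" and "U \<in> P"
  shows "r dvd l"
  using assms fixed_curve_eval_Psi_quotient[OF assms(1)] order[of l] class_prime_ideal.mult_mem[OF J]
  by (simp add: P_def)

text \<open>
  Under these assumptions both factors of \<open>Psi m q = Psi m 1 * (Psi m q / Psi m 1)\<close> vanish at
  the point.
\<close>

lemma derivation_Psi_mem:
  assumes "derivation D" and q: "r dvd q" and q1: "r = 1 \<Longrightarrow> p dvd q"
  shows "D (Psi m q) \<in> P"
proof -
  interpret D: derivation D by fact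
  obtain W G R where W0: "W 0 = 0"
    and rec: "\<And>j. W (Suc j) = W j + 1 + W j * deriv_x (Psi m 1)
           + Psi m 1 * (W j)\<^sup>2 * G + (Psi m 1)\<^sup>2 * R j"
    and W: "\<And>j. Psi m (j * 1) = Psi m 1 * W j"
    by (rule Psi_quotients[where q = 1 and m = m]) (rule that)
  have "W q \<in> P"
  proof (cases "r = 1")
    \<comment> \<open>For multiplier 1 the quotient takes the value \<open>q\<close> at the point,
      which is 0 modulo \<open>p\<close>.\<close>
    case True
    then have "deriv_x (Psi m 1) \<in> P" by (simp add: deriv_x_Psi_mem)
    then have "W q - of_nat q \<in> P" by (rule quotient_recursion_mod(1)[OF W0 rec Psi_mem])
    from mem_cong[OF this] show ?thesis using of_nat_mem[OF q1[OF True]] by simp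
  next
    \<comment> \<open>The multiplier is not 1 but its \<open>q\<close>-th power is, so the quotient
      must vanish.\<close>
    case False
    have "fixed_multiplier m ^ q - 1 \<in> J" using order q by blast
    then have "(fixed_multiplier m ^ 1 - 1) * fixed_curve_eval m (W q) \<in> J"
      using fixed_curve_eval_Psi_quotient[of m q 1 "W q"] W[of q] by simp
    moreover have "fixed_multiplier m ^ 1 - 1 \<notin> J" using order[of 1] False by simp
    ultimately show ?thesis using class_prime_ideal.prime_mem[OF J] by (auto simp: P_def)
  qed
  moreover have "D (Psi m q) = Psi m 1 * D (W q) + W q * D (Psi m 1)"
    using W[of q] by (simp add: D.mult)
  ultimately show ?thesis using Psi_mem by (simp add: mems)
qed

text \<open>
  Here \<open>m\<close> is odd, so \<open>deriv_x (unicritical_iter m q)\<close>, the product of the \<open>m f\<^sub>i ^ (m - 1)\<close>, is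
  a constant times a square.
\<close>

lemma derivation_multiplier_mem:
  assumes "derivation D" and "p = 2"
  shows "D (deriv_x (Psi m q)) \<in> P"
proof -
  interpret D: derivation D by fact
  define s where "s = (\<Prod>i<q. unicritical_iter m i ^ ((m - 1) div 2))"
  have "even (m - 1)" using p assms(2) by simp
  then have "y ^ (m - 1) = (y ^ ((m - 1) div 2))\<^sup>2" for y :: "int poly poly"
    by (simp flip: power_mult)
  then have "deriv_x (unicritical_iter m q) = of_nat (m ^ q) * s\<^sup>2"
    by (simp add: deriv_x_unicritical_iter prod.distrib s_def prod_power_distrib)
  then have "D (deriv_x (Psi m q)) = of_nat (m ^ q) * D (s\<^sup>2)"
    by (simp only: deriv_x_Psi D.diff D.mult D.one D.of_nat mult_zero_right add_0_right diff_0_right)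
  moreover have "(2 :: int poly poly) \<in> P" using of_nat_mem[of 2] assms(2) by simp
  then have "D (s\<^sup>2) \<in> P" using D.dvd_two_square dvd_mem by blast
  ultimately show ?thesis by (simp add: mems)
qed

lemma quotient_singular:
  assumes q: "r dvd q" and q1: "p \<le> 3 \<Longrightarrow> r = 1 \<Longrightarrow> p dvd q"
    and q0: "q > 0" and U: "Psi m (p * q) = Psi m q * U"
  shows "U \<in> P" and "derivation D \<Longrightarrow> D U \<in> P"
proof -
  obtain W G R where W0: "W 0 = 0"
    and rec: "\<And>j. W (Suc j) = W j + 1 + W j * deriv_x (Psi m q)
           + Psi m q * (W j)\<^sup>2 * G + (Psi m q)\<^sup>2 * R j"
    and W: "\<And>j. Psi m (j * q) = Psi m q * W j"
    by (rule Psi_quotients[where q = q and m = m]) (rule that)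
  have UW: "U = W p"
    using U W[of p] Psi_nonzero[OF m q0] by simp
  have h1: "deriv_x (Psi m q) \<in> P" using q by (simp add: deriv_x_Psi_mem)
  note mod = quotient_recursion_mod[OF W0 rec Psi_mem h1]
  have "W p - of_nat p \<in> P"
    by (rule mod(1))
  from mem_cong[OF this] show "U \<in> P" using of_nat_mem[of p] UW by simp
  assume D: "derivation D"
  have DW: "D (W p) - (of_nat (\<Sum>i<p. i) * D (deriv_x (Psi m q))
      + of_nat (\<Sum>i<p. i\<^sup>2) * G * D (Psi m q)) \<in> P"
    by (rule mod(2)[OF D])
  have "of_nat (\<Sum>i<p. i) * D (deriv_x (Psi m q)) \<in> P"
  proof (cases "p > 2")
    case True
    then show ?thesis using p(1) by (intro mult_mem' of_nat_mem dvd_sum_lessThan)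
  next
    case False
    then have "p = 2" using prime_ge_2_nat[OF p(1)] by simp
    then show ?thesis by (intro mult_mem derivation_multiplier_mem[OF D])
  qed
  moreover have "of_nat (\<Sum>i<p. i\<^sup>2) * G * D (Psi m q) \<in> P"
  proof (cases "p > 3")
    case True
    then show ?thesis using p(1) by (intro mult_mem' of_nat_mem dvd_sum_squares_lessThan)
  next
    \<comment> \<open>For \<open>p\<close> = 2 and 3 the sum of squares is 1 and 5, nonzero modulo
      \<open>p\<close>, so \<open>D (Psi m q)\<close> itself has to vanish.\<close>
    case False
    then show ?thesis using q1 by (intro mult_mem derivation_Psi_mem[OF D q]) simp_all
  qed
  ultimately show "D U \<in> P"
    unfolding UW mem_cong[OF DW] by (rule add_mem)
qed

end

theorem proposition7p1:
  fixes m n p :: nat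
  assumes "m \<ge> 2"
    and "prime p"
    and "\<not> p dvd m"
    and "p dvd n"
    and "n > 3"
  shows "Y1_bad_reduction m n p"
proof -
  have n0: "n > 0" using \<open>n > 3\<close> by simp
  define e where "e = multiplicity p n"
  obtain r where nr: "n = p ^ e * r" and r: "\<not> p dvd r"
    using multiplicity_decompose'[of n p] \<open>prime p\<close> n0 unfolding e_def
    by (metis not_prime_unit neq0_conv)
  have r0: "r > 0" using n0 nr by (cases r) auto
  have "e > 0" using nr r \<open>p dvd n\<close> by (cases e) auto
  define q where "q = p ^ (e - 1) * r"
  have nq: "n = p * q" using nr \<open>e > 0\<close> by (simp add: q_def power_eq_if)
  have q0: "q > 0" using nq n0 by (cases q) auto
  \<comment> \<open>Here \<open>n > 3\<close> matters: if \<open>r = 1\<close> and e = 1, then n = p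
    \<le> 3.\<close>
  have q1: "p dvd q" if "p \<le> 3" "r = 1"
  proof -
    have "e - 1 > 0"
      using \<open>n > 3\<close> that nq by (cases "e - 1") (auto simp: q_def)
    then show ?thesis by (simp add: q_def that)
  qed
  obtain J where "class_prime_ideal J" "of_nat p \<in> J"
    "\<And>k. fixed_multiplier m ^ k - 1 \<in> J \<longleftrightarrow> r dvd k"
    using exists_place_with_multiplier_order[OF assms(1-3) r0 r] by blast
  then interpret fixed_point_place m p r J
    using assms by (intro fixed_point_place.intro) auto
  define S where "S = {D. D dvd n \<and> squarefree D \<and> \<not> p dvd D}"
  have finS: "finite S" by (rule finite_subset[of _ "{D. D dvd n}"]) (use n0 in \<open>auto simp: S_def\<close>)
  have pD: "p * D dvd n" if "D \<in> S" for D
    using that assms by (auto simp: S_def intro!: divides_mult prime_imp_coprime)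
  have "\<exists>U. Psi m (n div D) = Psi m (n div (p * D)) * U" if "D \<in> S" for D
  proof -
    from pD[OF that] obtain k where k: "n = p * D * k" by blast
    then have "n div D = p * k" "n div (p * D) = k" using n0 by (auto simp: mult_ac)
    then show ?thesis using Psi_dvd_Psi[of k "p * k" m] by (auto elim: dvdE)
  qed
  then obtain U where U: "\<And>D. D \<in> S \<Longrightarrow> Psi m (n div D) = Psi m (n div (p * D)) * U D"
    by metis
  have pos: "n div D > 0" "n div (p * D) > 0" if "D \<in> S" for D
    using that pD[OF that] n0 by (auto simp: S_def elim!: dvdE)
  have monic: "lead_coeff (U D) = 1" if "D \<in> S" for D
    using arg_cong[OF U[OF that], of lead_coeff] Psi_monic(1)[OF \<open>m \<ge> 2\<close>] pos[OF that]
    by (simp add: lead_coeff_mult)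
  \<comment> \<open>The denominator and the rest of the numerator. Only \<open>A\<close> has to be
    nonzero at the point; zeros of \<open>B\<close> do no harm.\<close>
  define A B where "A = (\<Prod>D\<in>{D \<in> S. moebius_mu D = -1}. U D)"
    and "B = (\<Prod>D\<in>{D \<in> S. moebius_mu D = 1} - {1}. U D)"
  have one: "1 \<in> {D \<in> S. moebius_mu D = 1}"
    using \<open>prime p\<close> by (auto simp: S_def)
  have U_nonzero: "U D \<noteq> 0" if "D \<in> S" for D
    using monic[OF that] by auto
  have "to_fract (dynatomic m n) = (\<Prod>D\<in>S. to_fract (U D) powi moebius_mu D)"
    unfolding S_def to_fract_dynatomic[OF \<open>m \<ge> 2\<close> n0]
  proof (subst prod_powi_moebius_mu[OF \<open>prime p\<close> \<open>p dvd n\<close>], goal_cases)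
    case 2
    show ?case
      using U Psi_nonzero[OF \<open>m \<ge> 2\<close>] pos unfolding S_def
      by (intro prod.cong refl) (simp add: field_simps)
  qed (use n0 in simp)
  also have "\<dots> = (\<Prod>D\<in>{D \<in> S. moebius_mu D = 1}. to_fract (U D))
      / (\<Prod>D\<in>{D \<in> S. moebius_mu D = -1}. to_fract (U D))"
    by (rule prod_powi_sign[OF finS moebius_mu_range])
  also have "\<dots> = to_fract (U 1 * B) / to_fract A"
    unfolding A_def B_def using finS one by (subst prod.remove[of _ 1]) (simp_all add: to_fract_prod)
  finally have "to_fract (dynatomic m n * A) = to_fract (U 1 * B)"
    using U_nonzero by (simp add: A_def finS field_simps)
  then have eq: "dynatomic m n * A = U 1 * B" by (simp only: to_fract_eq_iff)
  have "A \<notin> P"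
  proof
    assume "A \<in> P"
    then obtain D where D: "D \<in> S" "moebius_mu D = -1" "U D \<in> P"
      using prod_mem[of "{D \<in> S. moebius_mu D = -1}" U] finS unfolding A_def by auto
    \<comment> \<open>Cancelling \<open>r\<close> in n = D (n/D) leaves \<open>D\<close> dividing
      p^e, so \<open>D = 1\<close>, where the Moebius function is 1 and not -1.\<close>
    have "r dvd n div D" using quotient_mem_imp_dvd[OF U] D by blast
    then obtain k where k: "n div D = r * k" by blast
    have "D dvd n" using D(1) by (simp add: S_def)
    then have "p ^ e * r = D * (n div D)" using nr by simp
    also have "\<dots> = D * k * r" by (simp add: k)
    finally have "p ^ e = D * k" using r0 by simp
    then have "D dvd p ^ e" by simp
    moreover have "coprime p D" using D(1) p(1) by (simp add: S_def prime_imp_coprime)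
    then have "coprime D (p ^ e)" by (simp add: coprime_commute)
    ultimately have "D = 1" using coprime_absorb_left[of D "p ^ e"] by simp
    then show False using D(2) by simp
  qed
  have U1: "Psi m (p * q) = Psi m q * U 1"
    using U[of 1] one nq q0 \<open>prime p\<close> by (simp add: prime_gt_0_nat)
  have "r dvd q" by (simp add: q_def)
  then have sing: "U 1 \<in> P" "\<And>D. derivation D \<Longrightarrow> D (U 1) \<in> P"
    using quotient_singular[of q "U 1"] q1 q0 U1 by blast+
  have \<Phi>: "dynatomic m n \<in> P"
  proof -
    have "dynatomic m n * A \<in> P" unfolding eq by (rule mult_mem'[OF sing(1)])
    then show ?thesis using \<open>A \<notin> P\<close> prime_mem by blast
  qed
  have D\<Phi>: "D (dynatomic m n) \<in> P" if "derivation D" for D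
  proof -
    interpret D: derivation D by fact
    have "D (dynatomic m n) * A = U 1 * D B + B * D (U 1) - dynatomic m n * D A"
      using arg_cong[OF eq, of D] by (simp add: D.mult algebra_simps)
    also have "\<dots> \<in> P" using sing(1) sing(2)[OF that] \<Phi> by (simp add: mems)
    finally show ?thesis using \<open>A \<notin> P\<close> prime_mem by blast
  qed
  \<comment> \<open>This excludes the case that the fibre is the whole plane; it holds because
    \<open>U 1 * B\<close> is monic in x.\<close>
  have "\<not> of_nat p dvd dynatomic m n"
  proof
    assume "of_nat p dvd dynatomic m n"
    then have "[:[:int p:]:] dvd U 1 * B"
      unfolding eq[symmetric] by (simp add: of_nat_poly)
    then have "[:int p:] dvd lead_coeff (U 1 * B)"
      by (rule const_poly_dvd_iff[THEN iffD1, THEN spec])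
    also have "\<dots> = 1"
      using one monic by (simp add: B_def lead_coeff_mult lead_coeff_prod)
    finally show False using \<open>prime p\<close> by (simp add: is_unit_const_poly_iff)
  qed
  moreover have "P \<in> fibre_points (dynatomic m n) p"
    unfolding fibre_points_def
    using primeideal_cring_class_ops of_nat_mem[of p] \<Phi> by simp
  ultimately show ?thesis
    using D\<Phi>[OF deriv_x.derivation_axioms] D\<Phi>[OF deriv_c.derivation_axioms]
    unfolding Y1_good_reduction_def smooth_fibre_def by blast
qed

end
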